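(* For every fixed integer $n\ge 3$, the sequence $\{k!\,\beta_{n,k}\}_{k=0}^{n-1}$ is log-concave.
   Context: The polynomials $p_n(w)$, $n\ge 1$, are defined by $p_1(w)=1$ and the recurrence $p_{n+1}(w) = -(nw+3n-1)p_n(w) + (1+w)p_n'(w)$ for $n\ge 1$. Each $p_n$ has degree at most $n-1$, and the coefficients $\beta_{n,k}$ ($0\le k\le n-1$) are defined by $p_n(w) = (-1)^{n-1}\sum_{k=0}^{n-1}\beta_{n,k}w^k$. A finite sequence $c_0,c_1,\ldots,c_N$ of real numbers is called log-concave if $c_{k-1}c_{k+1}\le c_k^2$ for all $1\le k\le N-1$. *)

theory Defs
  imports Complex_Main "HOL-Computational_Algebra.Polynomial"
begin

text \<open>
  The polynomials \<open>p\<^sub>n\<close> are indexed from \<open>n = 1\<close>; the value at index \<open>0\<close> is a dummy.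
  The third equation is the recurrence at \<open>Suc n\<close>; it is restated in the lemma \<open>p_poly_rec\<close>.
\<close>

fun p_poly :: "nat \<Rightarrow> real poly" where
  "p_poly 0 = 0"
| "p_poly (Suc 0) = 1"
| "p_poly (Suc (Suc n)) =
     - ([:3 * real (Suc n) - 1, real (Suc n):] * p_poly (Suc n))
     + [:1, 1:] * pderiv (p_poly (Suc n))"

definition beta :: "nat \<Rightarrow> nat \<Rightarrow> real" where
  "beta n k = (- 1) ^ (n - 1) * coeff (p_poly n) k"

definition log_concave :: "nat \<Rightarrow> (nat \<Rightarrow> real) \<Rightarrow> bool" where
  "log_concave N c \<longleftrightarrow> (\<forall>k. 1 \<le> k \<and> k < N \<longrightarrow> c (k - 1) * c (k + 1) \<le> (c k)\<^sup>2)"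

lemma p_poly_rec:
  assumes "n \<ge> 1"
  shows "poly (p_poly (n + 1)) w =
           - (real n * w + 3 * real n - 1) * poly (p_poly n) w
           + (1 + w) * poly (pderiv (p_poly n)) w"
  using assms by (cases n) (auto simp: algebra_simps)

lemma degree_p_poly: "degree (p_poly n) \<le> n - 1"
proof (induction n rule: p_poly.induct)
  case (3 n)
  have d: "degree (p_poly (Suc n)) \<le> n"
    using "3.IH" by simp
  have "degree ([:3 * real (Suc n) - 1, real (Suc n):] * p_poly (Suc n)) \<le> Suc n"
    using degree_mult_le[of "[:3 * real (Suc n) - 1, real (Suc n):]" "p_poly (Suc n)"] d
    by simp
  moreover have "degree ([:1, 1:] * pderiv (p_poly (Suc n))) \<le> Suc n"
    using degree_mult_le[of "[:1, 1:]" "pderiv (p_poly (Suc n))"] d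
    by (simp add: degree_pderiv)
  ultimately show ?case
    by (simp add: degree_diff_le del: mult_pCons_left)
qed simp_all

text \<open>The expansion that defines the coefficients \<open>\<beta>\<^bsub>n,k\<^esub>\<close>.\<close>

lemma p_poly_eq_sum_beta:
  assumes "n \<ge> 1"
  shows "p_poly n = smult ((- 1) ^ (n - 1)) (\<Sum>k=0..n - 1. monom (beta n k) k)"
proof (rule poly_eqI)
  fix j
  have "coeff (p_poly n) j = 0" if "j > n - 1"
    using that degree_p_poly[of n] by (intro coeff_eq_0) simp
  then show "coeff (p_poly n) j =
      coeff (smult ((- 1) ^ (n - 1)) (\<Sum>k=0..n - 1. monom (beta n k) k)) j"
    by (auto simp: coeff_sum beta_def simp flip: mult.assoc power_mult_distrib)
qed

end

theory Submission
  imports Defs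
begin

text \<open>
  Put \<open>u = 1 + w\<close> and \<open>q\<^sub>n(u) = (-1)\<^bsup>n-1\<^esup> p\<^sub>n(u - 1)\<close>. In this variable the recurrence loses
  its negative coefficients: \<open>d\<^sub>j = j! [u\<^sup>j] q\<^sub>n(u)\<close>, the derivatives of \<open>q\<^sub>n\<close> at \<open>0\<close>, satisfy
  \<open>d'\<^sub>j = (2n - 1 - j) d\<^sub>j + n j d\<^bsub>j-1\<^esub>\<close>, where \<open>d'\<close> belongs to \<open>n + 1\<close>, and \<open>d\<^sub>j\<close> is positive
  exactly for \<open>j < n\<close>. This step preserves log-concavity: in \<open>d'\<^sub>j\<^sup>2 - d'\<^bsub>j-1\<^esub> d'\<^bsub>j+1\<^esub>\<close>, what is
  not a nonnegative multiple of a minor of \<open>d\<close> adds up to the square \<open>(n d\<^bsub>j-1\<^esub> - d\<^sub>j)\<^sup>2\<close>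
  (lemma \<open>log_concave_step\<close>).

  The numbers \<open>k! \<beta>\<^bsub>n,k\<^esub>\<close> are the derivatives of the same \<open>q\<^sub>n\<close> at \<open>u = 1\<close>. It remains to move
  log-concavity of the sequence of derivatives from \<open>0\<close> to \<open>1\<close>, which works for every
  polynomial and every point \<open>x \<ge> 0\<close> (lemma \<open>ratio_decreasing_higher_pderiv\<close>): the
  two-by-two minors of the derivatives, as polynomials in \<open>x\<close>, have nonnegative coefficients,
  because their constant terms are the minors at \<open>0\<close> and the derivative of a minor is a sum
  of minors.
\<close>

section \<open>Sequences with decreasing ratios\<close>

text \<open>
  Log-concavity in a form with no division and no reference to the support: all minors
  are required to be nonnegative, not only the adjacent ones. For positive sequences the two
  are equivalent, but differentiating an adjacent minor of the derivatives of a polynomial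
  produces one that is not adjacent, so an induction needs them all.
\<close>

definition ratio_decreasing :: "(nat \<Rightarrow> real) \<Rightarrow> bool" where
  "ratio_decreasing d \<longleftrightarrow> (\<forall>i j. i \<le> j \<longrightarrow> d i * d (Suc j) \<le> d (Suc i) * d j)"

text \<open>
  Internal zeros would break the implication, hence the support is an initial segment; then
  adjacent minors can be chained by cancelling a positive entry.
\<close>

lemma ratio_decreasing_if_log_concave:
  assumes pos: "\<And>j. j < n \<Longrightarrow> d j > 0"
    and zero: "\<And>j. n \<le> j \<Longrightarrow> d j = 0"
    and lc: "\<And>j. d j * d (Suc (Suc j)) \<le> (d (Suc j))\<^sup>2"
  shows "ratio_decreasing d"
  unfolding ratio_decreasing_def
proof (intro allI impI)
  fix i j :: nat
  assume "i \<le> j"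
  then show "d i * d (Suc j) \<le> d (Suc i) * d j"
  proof (induction j rule: dec_induct)
    case base
    then show ?case by simp
  next
    case (step j)
    show ?case
    proof (cases "Suc (Suc j) < n")
      case True
      have p: "d (Suc j) > 0" "d (Suc (Suc j)) > 0" "d (Suc i) > 0"
        using True step.hyps pos by auto
      have "d i * d (Suc j) * d (Suc (Suc j)) \<le> d (Suc i) * d j * d (Suc (Suc j))"
        using step.IH p by (intro mult_right_mono) auto
      also have "\<dots> \<le> d (Suc i) * (d (Suc j))\<^sup>2"
        using lc[of j] p by (simp add: mult.assoc)
      finally have "(d i * d (Suc (Suc j))) * d (Suc j) \<le> (d (Suc i) * d (Suc j)) * d (Suc j)"
        by (simp add: power2_eq_square algebra_simps)
      then show ?thesis
        using p by (simp add: mult_right_le_imp_le)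
    next
      case False
      have nonneg: "d m \<ge> 0" for m
        using pos[of m] zero[of m] by (cases "m < n") auto
      show ?thesis
        using False zero[of "Suc (Suc j)"] nonneg by simp
    qed
  qed
qed

section \<open>Higher derivatives of a polynomial\<close>

lemma coeff_0_higher_pderiv:
  fixes f :: "real poly"
  shows "coeff ((pderiv ^^ k) f) 0 = fact k * coeff f k"
  by (simp add: coeff_higher_pderiv pochhammer_fact)

lemma higher_pderiv_pcompose_translation:
  fixes f :: "real poly"
  shows "(pderiv ^^ k) (pcompose f [:a, 1:]) = pcompose ((pderiv ^^ k) f) [:a, 1:]"
  by (induction k) (simp_all add: pderiv_pcompose pderiv_pCons)

text \<open>
  Differentiating the minor with indices \<open>i < j\<close> gives the sum of the minors with indices
  \<open>(i + 1, j)\<close> and \<open>(i, j + 1)\<close>, since the two products of middle terms cancel. This drives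
  an induction on the coefficient index, simultaneous in all pairs of indices.
\<close>

lemma coeff_derivative_minor_nonneg:
  fixes f :: "real poly"
  assumes "ratio_decreasing (\<lambda>k. coeff ((pderiv ^^ k) f) 0)" and "i \<le> j"
  shows "coeff ((pderiv ^^ Suc i) f * (pderiv ^^ j) f
            - (pderiv ^^ i) f * (pderiv ^^ Suc j) f) m \<ge> 0"
  using assms(2)
proof (induction m arbitrary: i j)
  case 0
  then show ?case
    using assms(1) unfolding ratio_decreasing_def by (simp add: coeff_mult)
next
  case (Suc m)
  let ?D = "\<lambda>i j. (pderiv ^^ Suc i) f * (pderiv ^^ j) f - (pderiv ^^ i) f * (pderiv ^^ Suc j) f"
  show ?case
  proof (cases "i = j")
    case False
    have "pderiv (?D i j) = ?D (Suc i) j + ?D i (Suc j)"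
      by (simp add: pderiv_diff pderiv_mult algebra_simps)
    then have "real (Suc m) * coeff (?D i j) (Suc m)
        = coeff (?D (Suc i) j) m + coeff (?D i (Suc j)) m"
      by (metis coeff_add coeff_pderiv)
    moreover have "coeff (?D (Suc i) j) m \<ge> 0" "coeff (?D i (Suc j)) m \<ge> 0"
      using Suc.IH[of "Suc i" j] Suc.IH[of i "Suc j"] Suc.prems False by simp_all
    ultimately have "real (Suc m) * coeff (?D i j) (Suc m) \<ge> 0"
      by linarith
    then show ?thesis
      by (simp add: zero_le_mult_iff del: funpow.simps)
  qed (simp add: mult.commute)
qed

lemma ratio_decreasing_higher_pderiv:
  fixes f :: "real poly"
  assumes "ratio_decreasing (\<lambda>k. fact k * coeff f k)" and "x \<ge> 0"
  shows "ratio_decreasing (\<lambda>k. poly ((pderiv ^^ k) f) x)"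
  unfolding ratio_decreasing_def
proof (intro allI impI)
  fix i j :: nat
  assume "i \<le> j"
  let ?D = "(pderiv ^^ Suc i) f * (pderiv ^^ j) f - (pderiv ^^ i) f * (pderiv ^^ Suc j) f"
  have "coeff ?D m \<ge> 0" for m
    using assms(1) \<open>i \<le> j\<close> by (intro coeff_derivative_minor_nonneg) (simp_all add: coeff_0_higher_pderiv)
  then have "poly ?D x \<ge> 0"
    unfolding poly_altdef using assms(2) by (intro sum_nonneg mult_nonneg_nonneg) auto
  then show "poly ((pderiv ^^ i) f) x * poly ((pderiv ^^ Suc j) f) x
      \<le> poly ((pderiv ^^ Suc i) f) x * poly ((pderiv ^^ j) f) x"
    by simp
qed

section \<open>The polynomials in the variable \<open>1 + w\<close>\<close>

definition shifted_poly :: "nat \<Rightarrow> real poly" where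
  "shifted_poly n = smult ((- 1) ^ (n - 1)) (pcompose (p_poly n) [:-1, 1:])"

lemma shifted_poly_1: "shifted_poly (Suc 0) = 1"
  by (simp add: shifted_poly_def pcompose_1)

lemma shifted_poly_Suc:
  "shifted_poly (Suc (Suc n)) =
     [:2 * real (Suc n) - 1, real (Suc n):] * shifted_poly (Suc n)
     - [:0, 1:] * pderiv (shifted_poly (Suc n))"
proof -
  have "pcompose [:3 * real (Suc n) - 1, real (Suc n):] [:-1, 1:]
      = [:2 * real (Suc n) - 1, real (Suc n):]"
    by (simp add: pcompose_pCons algebra_simps)
  moreover have "pcompose [:1, 1::real:] [:-1, 1:] = [:0, 1:]"
    by (simp add: pcompose_pCons)
  moreover have "pderiv [:-1, 1::real:] = 1"
    by (simp add: pderiv_pCons)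
  ultimately show ?thesis
    unfolding shifted_poly_def
    by (simp add: pcompose_add pcompose_diff pcompose_uminus pcompose_mult pderiv_smult
        pderiv_pcompose smult_add_right smult_diff_right
        del: mult_pCons_left mult_pCons_right)
qed

definition shifted_deriv :: "nat \<Rightarrow> nat \<Rightarrow> real" where
  "shifted_deriv n j = fact j * coeff (shifted_poly n) j"

lemma shifted_deriv_1: "shifted_deriv (Suc 0) j = (if j = 0 then 1 else 0)"
  by (simp add: shifted_deriv_def shifted_poly_1)

text \<open>At \<open>j = 0\<close> the factor \<open>j\<close> cancels the truncated index \<open>j - 1\<close>.\<close>

lemma shifted_deriv_Suc:
  "shifted_deriv (Suc (Suc n)) j =
     (2 * real (Suc n) - 1 - real j) * shifted_deriv (Suc n) j
     + real (Suc n) * real j * shifted_deriv (Suc n) (j - 1)"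
  by (cases j) (simp_all add: shifted_deriv_def shifted_poly_Suc coeff_pderiv algebra_simps)

lemma shifted_deriv_eq_0: "n < j \<Longrightarrow> shifted_deriv (Suc n) j = 0"
proof (induction n arbitrary: j)
  case (Suc n)
  then show ?case
    by (cases j) (simp_all add: shifted_deriv_Suc)
qed (simp add: shifted_deriv_1)

lemma shifted_deriv_pos: "j \<le> n \<Longrightarrow> shifted_deriv (Suc n) j > 0"
proof (induction n arbitrary: j)
  case (Suc n)
  show ?case
  proof (cases "j = Suc n")
    case True
    then show ?thesis
      using Suc.IH[of n] shifted_deriv_eq_0[of n "Suc n"] by (simp add: shifted_deriv_Suc)
  next
    case False
    then have "(2 * real (Suc n) - 1 - real j) * shifted_deriv (Suc n) j > 0"
      using Suc.prems Suc.IH[of j] by (intro mult_pos_pos) auto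
    moreover have "shifted_deriv (Suc n) (j - 1) > 0"
      using Suc.prems False Suc.IH[of "j - 1"] by simp
    ultimately show ?thesis
      by (simp add: shifted_deriv_Suc add_pos_nonneg)
  qed
qed (simp add: shifted_deriv_1)

text \<open>
  One step of the recurrence at \<open>t = j\<close> and \<open>s = 2n - 1\<close>, with \<open>a\<close>, \<open>b\<close>, \<open>c\<close>, \<open>e\<close> the
  consecutive entries \<open>d\<^bsub>j-2\<^esub>, \<dots>, d\<^bsub>j+1\<^esub>\<close>. The weights \<open>n t\<close> and \<open>s - t\<close> are linear in \<open>t\<close>, so
  comparing their squares with the products of their neighbours leaves \<open>n\<^sup>2\<close> and \<open>1\<close>, and the
  mixed weights leave \<open>-2 n\<close>: together these are the coefficients of \<open>(n b - c)\<^sup>2\<close>.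
\<close>

lemma log_concave_step:
  fixes n t s a b c e :: real
  assumes "n \<ge> 0" "t \<ge> 1" "s \<ge> t + 1"
    and "b * e \<le> c\<^sup>2"
    and "t > 1 \<Longrightarrow> a * c \<le> b\<^sup>2" "t > 1 \<Longrightarrow> a * e \<le> b * c"
  shows "((s - (t - 1)) * b + n * (t - 1) * a) * ((s - (t + 1)) * e + n * (t + 1) * c)
      \<le> ((s - t) * c + n * t * b)\<^sup>2"
proof -
  have "((s - t) * c + n * t * b)\<^sup>2
      - ((s - (t - 1)) * b + n * (t - 1) * a) * ((s - (t + 1)) * e + n * (t + 1) * c)
    = (n * b - c)\<^sup>2 + (s - (t - 1)) * (s - (t + 1)) * (c\<^sup>2 - b * e)
      + n\<^sup>2 * (t + 1) * ((t - 1) * (b\<^sup>2 - a * c))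
      + n * (s - (t + 1)) * ((t - 1) * (b * c - a * e))"
    by algebra
  moreover have "(t - 1) * (b\<^sup>2 - a * c) \<ge> 0" "(t - 1) * (b * c - a * e) \<ge> 0"
    using assms by (cases "t = 1"; simp)+
  ultimately show ?thesis
    using assms by (smt (verit) mult_nonneg_nonneg zero_le_power2)
qed

lemma shifted_deriv_ratio_decreasing: "ratio_decreasing (shifted_deriv (Suc n))"
proof (induction n)
  case 0
  then show ?case
    by (simp add: ratio_decreasing_def shifted_deriv_1)
next
  case (Suc n)
  define d where "d = shifted_deriv (Suc n)"
  have minor: "d i * d (Suc j) \<le> d (Suc i) * d j" if "i \<le> j" for i j
    using Suc.IH that unfolding d_def ratio_decreasing_def by blast
  have "shifted_deriv (Suc (Suc n)) j * shifted_deriv (Suc (Suc n)) (Suc (Suc j))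
      \<le> (shifted_deriv (Suc (Suc n)) (Suc j))\<^sup>2" for j
  proof (cases "Suc j \<le> n")
    case True
    have adj: "d i * d (Suc (Suc i)) \<le> (d (Suc i))\<^sup>2" for i
      using minor[of i "Suc i"] by (simp add: power2_eq_square)
    have "((2 * real (Suc n) - 1 - (real (Suc j) - 1)) * d j
          + real (Suc n) * (real (Suc j) - 1) * d (j - 1))
        * ((2 * real (Suc n) - 1 - (real (Suc j) + 1)) * d (Suc (Suc j))
          + real (Suc n) * (real (Suc j) + 1) * d (Suc j))
      \<le> ((2 * real (Suc n) - 1 - real (Suc j)) * d (Suc j) + real (Suc n) * real (Suc j) * d j)\<^sup>2"
    proof (rule log_concave_step)
      show "2 * real (Suc n) - 1 \<ge> real (Suc j) + 1"
        using True by simp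
      assume "real (Suc j) > 1"
      then obtain i where "j = Suc i"
        by (cases j) auto
      then show "d (j - 1) * d (Suc j) \<le> (d j)\<^sup>2" "d (j - 1) * d (Suc (Suc j)) \<le> d j * d (Suc j)"
        using adj[of i] minor[of i "Suc (Suc i)"] by simp_all
    qed (use adj in simp_all)
    then show ?thesis
      by (simp add: shifted_deriv_Suc d_def algebra_simps)
  next
    case False
    then show ?thesis
      by (simp add: shifted_deriv_eq_0)
  qed
  then show ?case
    by (intro ratio_decreasing_if_log_concave[where n = "Suc (Suc n)"])
      (simp_all add: shifted_deriv_pos shifted_deriv_eq_0)
qed

section \<open>Log-concavity\<close>

text \<open>Undoing the translation, \<open>w = 0\<close> corresponds to \<open>u = 1\<close>.\<close>

lemma fact_mult_beta:
  "fact k * beta n k = poly ((pderiv ^^ k) (shifted_poly n)) 1"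
proof -
  have "pcompose (shifted_poly n) [:1, 1:] = smult ((- 1) ^ (n - 1)) (p_poly n)"
    by (simp add: shifted_poly_def pcompose_smult pcompose_assoc[symmetric] pcompose_pCons)
  then have "beta n k = coeff (pcompose (shifted_poly n) [:1, 1:]) k"
    by (simp add: beta_def)
  then have "fact k * beta n k = coeff (pcompose ((pderiv ^^ k) (shifted_poly n)) [:1, 1:]) 0"
    by (simp flip: coeff_0_higher_pderiv add: higher_pderiv_pcompose_translation)
  also have "\<dots> = poly ((pderiv ^^ k) (shifted_poly n)) 1"
    by (simp flip: poly_0_coeff_0 add: poly_pcompose)
  finally show ?thesis .
qed

theorem theorem3p1:
  fixes n :: nat
  assumes "n \<ge> 3"
  shows "log_concave (n - 1) (\<lambda>k. fact k * beta n k)"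
  unfolding log_concave_def
proof (intro allI impI)
  fix k
  assume "1 \<le> k \<and> k < n - 1"
  then obtain i where k: "k = Suc i"
    by (cases k) auto
  obtain m where m: "n = Suc m"
    using assms by (cases n) auto
  have "ratio_decreasing (\<lambda>k. fact k * coeff (shifted_poly n) k)"
    using shifted_deriv_ratio_decreasing[of m] by (simp add: m shifted_deriv_def[abs_def])
  then have "ratio_decreasing (\<lambda>k. fact k * beta n k)"
    unfolding fact_mult_beta by (rule ratio_decreasing_higher_pderiv) simp
  then show "fact (k - 1) * beta n (k - 1) * (fact (k + 1) * beta n (k + 1)) \<le> (fact k * beta n k)\<^sup>2"
    unfolding ratio_decreasing_def k power2_eq_square
    by (metis Suc_eq_plus1 diff_Suc_1 le_SucI order_refl)
qed

end
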